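(* Let $\alpha,\beta,r,x$ be complex numbers with $\alpha\beta\neq 0$ and let $s>0$ be real. Then, as formal power series in $t$, $$\sum_{n=0}^{\infty}w_{n}^{(s)}(x;\alpha,\beta,r)\frac{t^{n}}{n!}=\left(\frac{1}{1-x\left((1+\alpha t)^{\beta/\alpha}-1\right)}\right)^{s}(1+\alpha t)^{r/\alpha}.$$
   Context: Here $(1+\alpha t)^{c/\alpha}=\exp\left(\frac{c}{\alpha}\log(1+\alpha t)\right)$ as a power series in $t$. The generalized Stirling numbers $S(n,k;\alpha,\beta,r)$ (for $\alpha\beta\ne0$) are characterised by: for every $n$-times differentiable $f$ on $(0,\infty)$, with $D=d/dx$, $$\left(\beta x^{1-\alpha/\beta}D\right)^{n}\left[x^{r/\beta}f(x)\right]=x^{(r-n\alpha)/\beta}\sum_{k=0}^{n}S(n,k;\alpha,\beta,r)\beta^{k}x^{k}f^{(k)}(x);$$ equivalently, by the generating function $$\left(\frac{(1+\alpha t)^{\beta/\alpha}-1}{\beta}\right)^{k}(1+\alpha t)^{r/\alpha}=k!\sum_{n=0}^{\infty}S(n,k;\alpha,\beta,r)\frac{t^{n}}{n!},$$ with $S(n,k;\alpha,\beta,r)=0$ for $k>n$. The rising factorial is $\langle y\rangle_{0}=1$, $\langle y\rangle_{k}=y(y+1)\cdots(y+k-1)$. The higher order generalized geometric polynomials are $$w_{n}^{(s)}(x;\alpha,\beta,r)=\sum_{k=0}^{n}S(n,k;\alpha,\beta,r)\langle s\rangle_{k}\,\beta^{k}x^{k}.$$ *)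

theory Defs
  imports Complex_Main "HOL-Computational_Algebra.Formal_Power_Series"
begin

(* f ^ a = exp (a * log f) with log f = log (1 + (f - 1)); fps_ln 1 is the series of
   log (1 + X).  Only meaningful for f with constant term 1, as otherwise f - 1 cannot be
   substituted into a power series. *)
definition fps_cpow :: "complex fps \<Rightarrow> complex \<Rightarrow> complex fps" where
  "fps_cpow f a = fps_exp a oo (fps_ln 1 oo (f - 1))"

(* (1 + alpha t) ^ (c / alpha) *)
definition alpha_pow :: "complex \<Rightarrow> complex \<Rightarrow> complex fps" where
  "alpha_pow \<alpha> c = fps_cpow (1 + fps_const \<alpha> * fps_X) (c / \<alpha>)"

(* S(n,k;alpha,beta,r), read off from the generating function; see gen_stirling_gf. *)
definition gen_stirling ::
  "nat \<Rightarrow> nat \<Rightarrow> complex \<Rightarrow> complex \<Rightarrow> complex \<Rightarrow> complex" where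
  "gen_stirling n k \<alpha> \<beta> r =
     fact n / fact k *
     fps_nth ((fps_const (1 / \<beta>) * (alpha_pow \<alpha> \<beta> - 1)) ^ k * alpha_pow \<alpha> r) n"

definition gen_geom_poly ::
  "nat \<Rightarrow> complex \<Rightarrow> complex \<Rightarrow> complex \<Rightarrow> complex \<Rightarrow> complex \<Rightarrow> complex" where
  "gen_geom_poly n s x \<alpha> \<beta> r =
     (\<Sum>k=0..n. gen_stirling n k \<alpha> \<beta> r * pochhammer s k * \<beta> ^ k * x ^ k)"

lemma gen_stirling_gf:
  "(fps_const (1 / \<beta>) * (alpha_pow \<alpha> \<beta> - 1)) ^ k * alpha_pow \<alpha> r =
     fps_const (fact k) * Abs_fps (\<lambda>n. gen_stirling n k \<alpha> \<beta> r / fact n)"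
  by (rule fps_ext) (simp add: gen_stirling_def)

lemma gen_stirling_eq_0:
  assumes "k > n"
  shows "gen_stirling n k \<alpha> \<beta> r = 0"
proof -
  let ?A = "fps_const (1 / \<beta>) * (alpha_pow \<alpha> \<beta> - 1)"
  have "fps_nth ?A 0 = 0"
    by (simp add: alpha_pow_def fps_cpow_def)
  then have "fps_nth (?A ^ k) i = 0" if "i < k" for i
    using that startsby_zero_power_prefix by blast
  then have "fps_nth (?A ^ k * alpha_pow \<alpha> r) n = 0"
    unfolding fps_mult_nth using assms by (intro sum.neutral) auto
  then show ?thesis
    by (simp add: gen_stirling_def)
qed

end

(* Substituting u = x ((1 + alpha t)^(beta/alpha) - 1) into the binomial series
   (1 - u)^(-s) = sum <s>_k u^k / k! and multiplying by (1 + alpha t)^(r/alpha), each term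
   is the generating function of S(n,k) up to the factor <s>_k beta^k x^k.  The remaining point
   is that exp (s log (1/(1 - u))) is that binomial series; both facts about complex powers
   needed for this follow from the uniqueness of solutions of (1 + X) y' = c y. *)
theory Submission
  imports Defs
begin

text \<open>\<open>fps_ln 1\<close> has derivative 1/(1 + X), so by the chain rule the composite
  solves (1 + X) y' = a y with y(0) = 1, which determines \<open>fps_binomial a\<close>.\<close>

lemma fps_exp_compose_ln: "fps_exp a oo fps_ln 1 = fps_binomial (a :: 'a :: field_char_0)"
proof -
  have "fps_deriv (fps_exp a oo fps_ln 1) = fps_const a * (fps_exp a oo fps_ln 1) / (1 + fps_X)"
    by (simp add: fps_compose_deriv fps_compose_mult_distrib fps_ln_deriv fps_divide_unit)
  then show ?thesis
    by (subst fps_binomial_ODE_unique' [symmetric]) simp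
qed

lemma fps_cpow_binomial:
  assumes "fps_nth f 0 = 1"
  shows "fps_cpow f a = fps_binomial a oo (f - 1)"
  unfolding fps_cpow_def using assms
  by (subst fps_compose_assoc) (simp_all add: fps_exp_compose_ln)

text \<open>This is the law (1/g)^a = g^(-a) for g = 1 + X. With v = 1/g - 1, the chain rule
  produces a y (1/(1 + v)) v' = a y g (-1/g^2) = -a y/g, the equation of
  \<open>fps_binomial (- a)\<close>.\<close>

lemma fps_binomial_compose_inverse:
  "fps_binomial a oo (inverse (1 + fps_X) - 1) = fps_binomial (- a :: 'a :: field_char_0)"
proof -
  define v :: "'a fps" where "v = inverse (1 + fps_X) - 1"
  have v0: "fps_nth v 0 = 0"
    by (simp add: v_def)
  have unit: "inverse (1 + fps_X) * (1 + fps_X :: 'a fps) = 1"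
    by (rule inverse_mult_eq_1) simp
  \<comment> \<open>Since 1 + v is the inverse of 1 + X, the denominator in the binomial equation
    becomes a factor 1 + X after substituting v.\<close>
  have inv_v: "inverse (1 + fps_X) oo v = 1 + fps_X"
  proof -
    have "inverse (1 + fps_X) oo v = inverse ((1 + fps_X) oo v)"
      using v0 by (intro fps_inverse_compose) simp_all
    also have "(1 + fps_X) oo v = inverse (1 + fps_X)"
      using v0 by (simp add: fps_compose_add_distrib v_def)
    finally show ?thesis
      by simp
  qed
  have dv: "fps_deriv v = - (inverse (1 + fps_X))\<^sup>2"
    by (simp add: v_def fps_inverse_deriv)
  have "fps_deriv (fps_binomial a oo v) =
      (fps_const a * (fps_binomial a oo v) * (1 + fps_X)) * - (inverse (1 + fps_X))\<^sup>2"
    using v0 by (simp add: fps_compose_deriv fps_binomial_deriv fps_divide_unit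
        fps_compose_mult_distrib inv_v dv)
  also have "\<dots> = - (fps_const a * (fps_binomial a oo v) *
      (inverse (1 + fps_X) * (1 + fps_X)) * inverse (1 + fps_X))"
    by (simp only: power2_eq_square mult_minus_right mult.assoc mult.commute mult.left_commute)
  also have "\<dots> = fps_const (- a) * (fps_binomial a oo v) / (1 + fps_X)"
    by (simp add: unit fps_divide_unit flip: fps_const_neg)
  finally show ?thesis
    by (subst fps_binomial_ODE_unique' [symmetric]) (simp add: v_def)
qed

text \<open>The general case comes from the case 1 + X by substituting f - 1 for X.\<close>

lemma fps_cpow_inverse:
  assumes "fps_nth f 0 = 1"
  shows "fps_cpow (1 / f) a = fps_cpow f (- a)"
proof -
  have f1: "fps_nth (f - 1) 0 = 0"
    using assms by simp
  have "(inverse (1 + fps_X) - 1) oo (f - 1) = 1 / f - 1"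
    using f1 assms
    by (simp add: fps_compose_sub_distrib fps_inverse_compose fps_compose_add_distrib
        fps_divide_unit)
  then have "fps_binomial a oo (1 / f - 1) =
      fps_binomial a oo (inverse (1 + fps_X) - 1) oo (f - 1)"
    using f1 by (subst fps_compose_assoc [symmetric]) simp_all
  then show ?thesis
    using assms by (simp add: fps_cpow_binomial fps_divide_unit fps_binomial_compose_inverse)
qed

lemma fps_compose_mult_nth:
  fixes a b u :: "'a :: comm_ring_1 fps"
  assumes "fps_nth u 0 = 0"
  shows "fps_nth ((a oo u) * b) n = (\<Sum>k=0..n. fps_nth a k * fps_nth (u ^ k * b) n)"
proof -
  \<comment> \<open>As u has no constant term, \<open>u ^ k\<close> vanishes below degree k; the
    range k \<le> i can thus be enlarged to k \<le> n for all i at once, which makes the two sums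
    interchangeable.\<close>
  have "fps_nth (a oo u) i = (\<Sum>k=0..n. fps_nth a k * fps_nth (u ^ k) i)" if "i \<le> n" for i
    unfolding fps_compose_nth using that assms
    by (intro sum.mono_neutral_left) (auto simp: startsby_zero_power_prefix)
  then have "fps_nth ((a oo u) * b) n =
      (\<Sum>i=0..n. \<Sum>k=0..n. fps_nth a k * fps_nth (u ^ k) i * fps_nth b (n - i))"
    by (simp add: fps_mult_nth sum_distrib_right)
  also have "\<dots> = (\<Sum>k=0..n. \<Sum>i=0..n. fps_nth a k * fps_nth (u ^ k) i * fps_nth b (n - i))"
    by (rule sum.swap)
  finally show ?thesis
    by (simp add: fps_mult_nth sum_distrib_left mult.assoc)
qed

theorem theorem1:
  fixes \<alpha> \<beta> r x :: complex and s :: real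
  assumes "\<alpha> * \<beta> \<noteq> 0" and "s > 0"
  shows "Abs_fps (\<lambda>n. gen_geom_poly n (complex_of_real s) x \<alpha> \<beta> r / fact n) =
    fps_cpow (1 / (1 - fps_const x * (alpha_pow \<alpha> \<beta> - 1))) (complex_of_real s) *
    alpha_pow \<alpha> r"
proof (rule fps_ext)
  fix n
  define s' where "s' = complex_of_real s"
  define A where "A = fps_const (1 / \<beta>) * (alpha_pow \<alpha> \<beta> - 1)"
  define u where "u = fps_const x * (alpha_pow \<alpha> \<beta> - 1)"
  have u0: "fps_nth u 0 = 0"
    by (simp add: u_def alpha_pow_def fps_cpow_def)
  \<comment> \<open>Writing u through A, the base in the definition of \<open>gen_stirling\<close>,
    is what brings in the powers of \<beta>.\<close>
  have u_eq: "- u = fps_const (- (x * \<beta>)) * A"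
    using assms(1) by (simp add: u_def A_def mult.assoc [symmetric] flip: fps_const_neg)
  have power: "fps_nth ((- u) ^ k * alpha_pow \<alpha> r) n =
      (- 1) ^ k * \<beta> ^ k * x ^ k * (fact k / fact n * gen_stirling n k \<alpha> \<beta> r)" for k
    unfolding u_eq gen_stirling_def A_def [symmetric]
    by (simp add: power_mult_distrib fps_const_power mult.assoc power_minus [of "x * \<beta>"])
  have "fps_cpow (1 / (1 - u)) s' = fps_binomial (- s') oo - u"
    using u0 fps_cpow_inverse [of "1 - u" s'] fps_cpow_binomial [of "1 - u" "- s'"] by simp
  then have "fps_nth (fps_cpow (1 / (1 - u)) s' * alpha_pow \<alpha> r) n =
      (\<Sum>k=0..n. (- s' gchoose k) * fps_nth ((- u) ^ k * alpha_pow \<alpha> r) n)"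
    using u0 by (simp add: fps_compose_mult_nth)
  also have "\<dots> = (\<Sum>k=0..n. gen_stirling n k \<alpha> \<beta> r * pochhammer s' k * \<beta> ^ k * x ^ k / fact n)"
  proof (intro sum.cong refl)
    fix k
    \<comment> \<open>One sign comes from \<open>(- u) ^ k\<close>, the other from (-s gchoose k) =
      (-1)^k <s>_k / k!; the k! cancels against the one in \<open>power\<close>.\<close>
    have "(- 1) ^ k * (- 1) ^ k = (1 :: complex)"
      by (simp flip: power_mult_distrib)
    then show "(- s' gchoose k) * fps_nth ((- u) ^ k * alpha_pow \<alpha> r) n =
        gen_stirling n k \<alpha> \<beta> r * pochhammer s' k * \<beta> ^ k * x ^ k / fact n"
      unfolding power gbinomial_pochhammer by (simp add: field_simps)
  qed
  finally show "fps_nth (Abs_fps (\<lambda>n. gen_geom_poly n (complex_of_real s) x \<alpha> \<beta> r / fact n)) n =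
    fps_nth (fps_cpow (1 / (1 - fps_const x * (alpha_pow \<alpha> \<beta> - 1))) (complex_of_real s) *
      alpha_pow \<alpha> r) n"
    by (simp add: gen_geom_poly_def u_def s'_def sum_divide_distrib)
qed

end
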